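(* For each integer $n$, there exists a map $h'_n:\mathbb{R}\mathrm{P}^3\to S^2$ such that the composite $h'_n\circ\mathfrak{p}_3:S^3\to S^2$ is homotopic to $nh$.
   Context: "Map" means continuous map. The sphere $S^3$ is $\{(z_1,z_2)\in\mathbb{C}^2 : |z_1|^2+|z_2|^2=1\}$. The circle $S^1=\{\lambda\in\mathbb{C}:|\lambda|=1\}$ acts on $S^3$ by $(\lambda,(z_1,z_2))\mapsto(\lambda z_1,\lambda z_2)$; the orbit of $(z_1,z_2)$ is denoted $S^1(z_1,z_2)$. The orbit space $S^3/S^1$ is $\mathbb{C}\mathrm{P}^1$, identified with $S^2$, and the Hopf fibration $h:S^3\to S^2$ sends $(z_1,z_2)$ to the class $[S^1(z_1,z_2)]$ of its orbit. The group $\pi_3(S^2)\approx\mathbb{Z}$ is generated by $[h]$, identified with $1$. For $n\in\mathbb{Z}$, $nh:S^3\to S^2$ denotes any map in the homotopy class $n[h]$; such a map is obtained by composing a self-map of $S^3$ of degree $n$ with $h$, i.e. as $h\circ a$ with $\deg a=n$. The map $\mathfrak{p}_3:S^3\to\mathbb{R}\mathrm{P}^3$, $(z_1,z_2)\mapsto[z_1,z_2]$, is the double covering which identifies antipodal points. *)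

theory Defs
  imports "HOL-Analysis.Analysis" "HOL-Algebra.Group"
begin

section \<open>Quotient topologies\<close>

definition quotient_topology :: "'a topology \<Rightarrow> ('a \<Rightarrow> 'b) \<Rightarrow> 'b topology" where
  "quotient_topology X q =
     topology (\<lambda>U. U \<subseteq> q ` topspace X \<and> openin X {x \<in> topspace X. q x \<in> U})"

lemma openin_quotient_topology:
  "openin (quotient_topology X q) U \<longleftrightarrow>
     U \<subseteq> q ` topspace X \<and> openin X {x \<in> topspace X. q x \<in> U}"
proof -
  have "istopology (\<lambda>U. U \<subseteq> q ` topspace X \<and> openin X {x \<in> topspace X. q x \<in> U})"
    unfolding istopology_def
  proof (intro conjI allI impI)
    fix S T
    assume S: "S \<subseteq> q ` topspace X \<and> openin X {x \<in> topspace X. q x \<in> S}"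
      and T: "T \<subseteq> q ` topspace X \<and> openin X {x \<in> topspace X. q x \<in> T}"
    show "S \<inter> T \<subseteq> q ` topspace X" using S by blast
    have "{x \<in> topspace X. q x \<in> S \<inter> T}
            = {x \<in> topspace X. q x \<in> S} \<inter> {x \<in> topspace X. q x \<in> T}"
      by auto
    then show "openin X {x \<in> topspace X. q x \<in> S \<inter> T}" using S T by auto
  next
    fix K
    assume K: "\<forall>S\<in>K. S \<subseteq> q ` topspace X \<and> openin X {x \<in> topspace X. q x \<in> S}"
    show "\<Union>K \<subseteq> q ` topspace X" using K by blast
    have "{x \<in> topspace X. q x \<in> \<Union>K} = (\<Union>S\<in>K. {x \<in> topspace X. q x \<in> S})"
      by auto
    then show "openin X {x \<in> topspace X. q x \<in> \<Union>K}" using K by auto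
  qed
  then show ?thesis
    by (simp add: quotient_topology_def topology_inverse')
qed

lemma topspace_quotient_topology [simp]: "topspace (quotient_topology X q) = q ` topspace X"
proof -
  have "{x \<in> topspace X. q x \<in> q ` topspace X} = topspace X" by auto
  then have "openin (quotient_topology X q) (q ` topspace X)"
    by (simp add: openin_quotient_topology)
  then show ?thesis
    by (meson openin_quotient_topology openin_subset openin_topspace subset_antisym)
qed

lemma quotient_map_quotient_topology: "quotient_map X (quotient_topology X q) q"
  by (auto simp: quotient_map_def openin_quotient_topology)


section \<open>Spheres, projective spaces and the Hopf fibration\<close>

text \<open>The product norm on \<^typ>\<open>complex \<times> complex\<close> is the Euclidean one, so this is the set of
  pairs with \<open>|z1|^2 + |z2|^2 = 1\<close>.\<close>

definition S3 :: "(complex \<times> complex) topology" where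
  "S3 = top_of_set (sphere 0 1)"

definition S2 :: "(real^3) topology" where
  "S2 = top_of_set (sphere 0 1)"

definition antipodal_class :: "complex \<times> complex \<Rightarrow> (complex \<times> complex) set" where
  "antipodal_class z = {z, - z}"

abbreviation p3 :: "complex \<times> complex \<Rightarrow> (complex \<times> complex) set" where
  "p3 \<equiv> antipodal_class"

definition RP3 :: "(complex \<times> complex) set topology" where
  "RP3 = quotient_topology S3 p3"

definition S1_orbit :: "complex \<times> complex \<Rightarrow> (complex \<times> complex) set" where
  "S1_orbit z = (\<lambda>l. (l * fst z, l * snd z)) ` sphere 0 1"

definition CP1 :: "(complex \<times> complex) set topology" where
  "CP1 = quotient_topology S3 S1_orbit"

text \<open>The argument \<open>\<phi>\<close> is a homeomorphism from \<^term>\<open>CP1\<close> to \<^term>\<open>S2\<close> by which the orbit space is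
  identified with the sphere.\<close>

definition hopf :: "((complex \<times> complex) set \<Rightarrow> real^3) \<Rightarrow> complex \<times> complex \<Rightarrow> real^3" where
  "hopf \<phi> z = \<phi> (S1_orbit z)"

lemma in_sphere_complex_pair:
  "z \<in> sphere (0::complex \<times> complex) 1 \<longleftrightarrow> (cmod (fst z))\<^sup>2 + (cmod (snd z))\<^sup>2 = 1"
  by (cases z) (auto simp: norm_Pair)

lemma S1_orbit_eq_iff:
  "S1_orbit z = S1_orbit w \<longleftrightarrow> (\<exists>l. cmod l = 1 \<and> w = (l * fst z, l * snd z))"
proof
  assume "S1_orbit z = S1_orbit w"
  moreover have "w \<in> S1_orbit w"
    unfolding S1_orbit_def by (rule image_eqI[of _ _ 1]) auto
  ultimately have "w \<in> S1_orbit z" by simp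
  then show "\<exists>l. cmod l = 1 \<and> w = (l * fst z, l * snd z)"
    by (auto simp: S1_orbit_def)
next
  assume "\<exists>l. cmod l = 1 \<and> w = (l * fst z, l * snd z)"
  then obtain l where l: "cmod l = 1" "w = (l * fst z, l * snd z)" by blast
  have l0: "l \<noteq> 0" using l by auto
  show "S1_orbit z = S1_orbit w"
  proof
    show "S1_orbit z \<subseteq> S1_orbit w"
    proof
      fix u assume "u \<in> S1_orbit z"
      then obtain m where m: "cmod m = 1" "u = (m * fst z, m * snd z)"
        by (auto simp: S1_orbit_def)
      show "u \<in> S1_orbit w"
        unfolding S1_orbit_def
        by (rule image_eqI[of _ _ "m / l"]) (use l l0 m in \<open>auto simp: norm_divide\<close>)
    qed
    show "S1_orbit w \<subseteq> S1_orbit z"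
    proof
      fix u assume "u \<in> S1_orbit w"
      then obtain m where m: "cmod m = 1" "u = (m * fst w, m * snd w)"
        by (auto simp: S1_orbit_def)
      show "u \<in> S1_orbit z"
        unfolding S1_orbit_def
        by (rule image_eqI[of _ _ "m * l"]) (use l m in \<open>auto simp: norm_mult\<close>)
    qed
  qed
qed

definition hopf_formula :: "complex \<times> complex \<Rightarrow> real^3" where
  "hopf_formula z = vector [2 * Re (fst z * cnj (snd z)), 2 * Im (fst z * cnj (snd z)),
                            (cmod (fst z))\<^sup>2 - (cmod (snd z))\<^sup>2]"

lemma in_sphere_real3: "x \<in> sphere (0::real^3) 1 \<longleftrightarrow> (x$1)\<^sup>2 + (x$2)\<^sup>2 + (x$3)\<^sup>2 = 1"
proof -
  have "norm x = sqrt ((x$1)\<^sup>2 + (x$2)\<^sup>2 + (x$3)\<^sup>2)"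
    by (simp add: norm_vec_def L2_set_def sum_3)
  then show ?thesis by simp
qed

lemma hopf_formula_in: 
  assumes "z \<in> sphere 0 1" shows "hopf_formula z \<in> sphere 0 1"
proof -
  obtain a b c d where z: "z = (Complex a b, Complex c d)"
    by (metis complex.collapse prod.collapse)
  have 1: "a\<^sup>2 + b\<^sup>2 + (c\<^sup>2 + d\<^sup>2) = 1"
    using in_sphere_complex_pair[THEN iffD1, OF assms] by (simp add: z cmod_power2)
  have "(2 * (a * c + b * d))\<^sup>2 + (2 * (b * c - a * d))\<^sup>2 + (a\<^sup>2 + b\<^sup>2 - (c\<^sup>2 + d\<^sup>2))\<^sup>2
        = (a\<^sup>2 + b\<^sup>2 + (c\<^sup>2 + d\<^sup>2))\<^sup>2"
    by algebra
  then show ?thesis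
    unfolding in_sphere_real3 by (simp add: 1 hopf_formula_def z cmod_power2)
qed

lemma hopf_formula_eq_imp:
  assumes z: "z \<in> sphere 0 1" and w: "w \<in> sphere 0 1" and eq: "hopf_formula z = hopf_formula w"
  shows "S1_orbit z = S1_orbit w"
proof -
  obtain z1 z2 w1 w2 where zw: "z = (z1, z2)" "w = (w1, w2)" by (metis prod.collapse)
  have "hopf_formula z $ i = hopf_formula w $ i" for i using eq by simp
  from this[of 1] this[of 2] this[of 3]
  have re: "Re (z1 * cnj z2) = Re (w1 * cnj w2)" and im: "Im (z1 * cnj z2) = Im (w1 * cnj w2)"
    and d: "(cmod z1)\<^sup>2 - (cmod z2)\<^sup>2 = (cmod w1)\<^sup>2 - (cmod w2)\<^sup>2"
    by (simp_all add: hopf_formula_def zw)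
  have p: "z1 * cnj z2 = w1 * cnj w2" using re im by (simp add: complex_eq_iff)
  have s: "(cmod z1)\<^sup>2 + (cmod z2)\<^sup>2 = 1" "(cmod w1)\<^sup>2 + (cmod w2)\<^sup>2 = 1"
    using z[unfolded in_sphere_complex_pair] w[unfolded in_sphere_complex_pair]
    by (simp_all add: zw)
  have "(cmod z1)\<^sup>2 = (cmod w1)\<^sup>2" "(cmod z2)\<^sup>2 = (cmod w2)\<^sup>2" using s d by linarith+
  then have n: "cmod z1 = cmod w1" "cmod z2 = cmod w2" by (simp_all add: power2_eq_iff_nonneg)
  have "\<exists>l. cmod l = 1 \<and> w1 = l * z1 \<and> w2 = l * z2"
  proof (cases "z1 = 0")
    case True
    then have "w1 = 0" "z2 \<noteq> 0" using n s by auto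
    then show ?thesis
      using True n by (intro exI[of _ "w2 / z2"]) (auto simp: norm_divide)
  next
    case False
    define l where "l = w1 / z1"
    have l: "cmod l = 1" "w1 = l * z1" using False n by (auto simp: l_def norm_divide)
    have "cnj z2 = l * cnj w2" using p False l by simp
    then have "z2 = cnj l * w2" by (metis complex_cnj_cnj complex_cnj_mult)
    then have "l * z2 = (l * cnj l) * w2" by simp
    also have "l * cnj l = 1" using l by (simp add: complex_norm_square[symmetric])
    finally show ?thesis using l by auto
  qed
  then show ?thesis by (auto simp: S1_orbit_eq_iff zw)
qed

lemma hopf_formula_surj:
  assumes "x \<in> sphere 0 1" shows "\<exists>z \<in> sphere 0 1. hopf_formula z = x"
proof -
  define r where "r = x $ 3"
  define v where "v = Complex (x$1) (x$2)"
  have v: "(cmod v)\<^sup>2 + r\<^sup>2 = 1"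
    using in_sphere_real3[THEN iffD1, OF assms] by (simp add: v_def r_def cmod_power2)
  then have "r\<^sup>2 \<le> 1" using zero_le_power2[of "cmod v"] by linarith
  then have r: "-1 \<le> r" "r \<le> 1" by (auto simp: abs_square_le_1 abs_le_iff)
  have *: "\<exists>z1 z2. (cmod z1)\<^sup>2 + (cmod z2)\<^sup>2 = 1 \<and> 2 * (z1 * cnj z2) = v
             \<and> (cmod z1)\<^sup>2 - (cmod z2)\<^sup>2 = r"
  proof (cases "r = -1")
    case True
    then have "v = 0" using v by simp
    then show ?thesis using True by (intro exI[of _ 0] exI[of _ 1]) auto
  next
    case False
    define s where "s = sqrt ((1 + r) / 2)"
    have s: "s > 0" "s\<^sup>2 = (1 + r) / 2" using False r by (auto simp: s_def)
    have "(cmod v)\<^sup>2 = (1 + r) * (1 - r)" using v by (simp add: algebra_simps power2_eq_square)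
    then have vs: "(cmod v)\<^sup>2 = 2 * s\<^sup>2 * (1 - r)" using s by (simp add: field_simps)
    have "(cmod (cnj v / (2 * of_real s)))\<^sup>2 = (cmod v)\<^sup>2 / (4 * s\<^sup>2)"
      using s(1) by (simp add: norm_divide norm_mult power_divide power_mult_distrib)
    then have q: "(cmod (cnj v / (2 * of_real s)))\<^sup>2 = (1 - r) / 2"
      unfolding vs using s(1) by simp
    show ?thesis
      by (rule exI[of _ "of_real s"], rule exI[of _ "cnj v / (2 * of_real s)"])
         (use s q in \<open>simp add: field_simps\<close>)
  qed
  then obtain z1 z2 where z: "(cmod z1)\<^sup>2 + (cmod z2)\<^sup>2 = 1" "2 * (z1 * cnj z2) = v"
    "(cmod z1)\<^sup>2 - (cmod z2)\<^sup>2 = r" by blast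
  have "2 * Re (z1 * cnj z2) = Re v" "2 * Im (z1 * cnj z2) = Im v"
    using z(2) by auto
  then have "hopf_formula (z1, z2) = x"
    using z(3) by (simp add: hopf_formula_def vec_eq_iff forall_3 v_def r_def)
  then show ?thesis using z(1) by (intro bexI[of _ "(z1, z2)"]) (auto simp: norm_Pair)
qed

lemma continuous_on_hopf_formula: "continuous_on S hopf_formula"
proof -
  have "continuous_on S (\<lambda>z. hopf_formula z $ i)" for i
  proof -
    have "\<forall>i. continuous_on S (\<lambda>z. hopf_formula z $ i)"
      unfolding forall_3 hopf_formula_def
      by (auto intro!: continuous_intros)
    then show ?thesis by blast
  qed
  then have "continuous_on S (\<lambda>z. \<chi> i. hopf_formula z $ i)"
    by (intro continuous_on_vec_lambda)
  then show ?thesis by simp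
qed

theorem CP1_homeomorphic_S2: "CP1 homeomorphic_space S2"
proof -
  have q: "quotient_map S3 CP1 S1_orbit"
    unfolding CP1_def by (rule quotient_map_quotient_topology)
  have cont: "continuous_map S3 S2 hopf_formula"
    unfolding S3_def S2_def
    by (rule continuous_map_into_subtopology)
      (use hopf_formula_in in \<open>simp_all add: continuous_on_hopf_formula image_subset_iff\<close>)
  have fibres: "hopf_formula z = hopf_formula w" if eq: "S1_orbit z = S1_orbit w" for z w
  proof -
    obtain l where l: "cmod l = 1" "w = (l * fst z, l * snd z)"
      using eq S1_orbit_eq_iff[of z w] by blast
    have "l * cnj l = 1" using l by (simp add: complex_norm_square[symmetric])
    moreover have "fst w * cnj (snd w) = (l * cnj l) * (fst z * cnj (snd z))"
      using l(2) by simp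
    ultimately have "fst w * cnj (snd w) = fst z * cnj (snd z)" by simp
    moreover have "cmod (fst w) = cmod (fst z)" "cmod (snd w) = cmod (snd z)"
      using l by (simp_all add: norm_mult)
    ultimately show ?thesis
      by (simp only: hopf_formula_def)
  qed
  obtain g where g: "continuous_map CP1 S2 g" "g ` topspace CP1 = hopf_formula ` topspace S3"
    "\<And>z. z \<in> topspace S3 \<Longrightarrow> g (S1_orbit z) = hopf_formula z"
    by (rule quotient_map_lift_exists[OF q cont fibres], assumption) (rule that)
  have tS3: "topspace S3 = sphere 0 1" by (simp add: S3_def)
  have "homeomorphic_map CP1 S2 g"
  proof (rule continuous_imp_homeomorphic_map[OF g(1)])
    have "compact_space S3" by (simp add: S3_def compact_space_subtopology)
    then show "compact_space CP1"
      using image_compactin[OF _ quotient_imp_continuous_map[OF q], of "topspace S3"]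
        quotient_imp_surjective_map[OF q]
      by (simp add: compact_space_def)
    show "Hausdorff_space S2" by (simp add: S2_def Hausdorff_space_subtopology)
    show "g ` topspace CP1 = topspace S2"
    proof -
      have "topspace S2 = sphere 0 1" by (simp add: S2_def)
      moreover have "hopf_formula ` sphere 0 1 = sphere 0 1"
      proof
        show "hopf_formula ` sphere 0 1 \<subseteq> sphere 0 1" using hopf_formula_in by blast
        show "sphere 0 1 \<subseteq> hopf_formula ` sphere 0 1"
        proof
          fix x :: "real^3" assume "x \<in> sphere 0 1"
          then obtain z where "z \<in> sphere 0 1" "hopf_formula z = x" using hopf_formula_surj by blast
          then show "x \<in> hopf_formula ` sphere 0 1" by blast
        qed
      qed
      ultimately show ?thesis unfolding g(2) tS3 by (rule trans[OF _ sym, rotated])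
    qed
    show "inj_on g (topspace CP1)"
    proof (rule inj_onI)
      fix a b assume ab: "a \<in> topspace CP1" "b \<in> topspace CP1" "g a = g b"
      have "topspace CP1 = S1_orbit ` sphere 0 1" by (simp add: CP1_def tS3)
      then have "a \<in> S1_orbit ` sphere 0 1" "b \<in> S1_orbit ` sphere 0 1" using ab(1,2) by simp_all
      then obtain z w where zw: "z \<in> sphere 0 1" "w \<in> sphere 0 1" "a = S1_orbit z" "b = S1_orbit w"
        by (elim imageE)
      have "hopf_formula z = hopf_formula w"
        using ab(3) g(3)[unfolded tS3, OF zw(1)] g(3)[unfolded tS3, OF zw(2)] zw(3,4) by simp
      then show "a = b" unfolding zw(3,4) by (rule hopf_formula_eq_imp[OF zw(1,2)])
    qed
  qed
  then show ?thesis by (rule homeomorphic_map_imp_homeomorphic_space)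
qed


section \<open>The third homotopy group\<close>

text \<open>\<open>\<pi>\<^sub>3(X, x0)\<close> is modelled by maps of the unit cube into \<open>X\<close> that send the boundary to \<open>x0\<close>, up to
  homotopy relative to the boundary, with concatenation in the first coordinate. The group is
  written multiplicatively.\<close>

definition cube3 :: "(real \<times> real \<times> real) set" where
  "cube3 = {0..1} \<times> {0..1} \<times> {0..1}"

definition cube3_boundary :: "(real \<times> real \<times> real) set" where
  "cube3_boundary = {(r, s, t) \<in> cube3. r \<in> {0, 1} \<or> s \<in> {0, 1} \<or> t \<in> {0, 1}}"

definition cube_maps :: "'a topology \<Rightarrow> 'a \<Rightarrow> (real \<times> real \<times> real \<Rightarrow> 'a) set" where
  "cube_maps X x0 = {f. continuous_map (top_of_set cube3) X f \<and> (\<forall>p\<in>cube3_boundary. f p = x0)}"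

definition cube_homotopic ::
  "'a topology \<Rightarrow> 'a \<Rightarrow> (real \<times> real \<times> real \<Rightarrow> 'a) \<Rightarrow> (real \<times> real \<times> real \<Rightarrow> 'a) \<Rightarrow> bool" where
  "cube_homotopic X x0 = homotopic_with (\<lambda>k. \<forall>p\<in>cube3_boundary. k p = x0) (top_of_set cube3) X"

definition cube_class ::
  "'a topology \<Rightarrow> 'a \<Rightarrow> (real \<times> real \<times> real \<Rightarrow> 'a) \<Rightarrow> (real \<times> real \<times> real \<Rightarrow> 'a) set" where
  "cube_class X x0 f = {g. cube_homotopic X x0 f g}"

definition cube_concat ::
  "(real \<times> real \<times> real \<Rightarrow> 'a) \<Rightarrow> (real \<times> real \<times> real \<Rightarrow> 'a) \<Rightarrow> real \<times> real \<times> real \<Rightarrow> 'a" where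
  "cube_concat f g = (\<lambda>(r, p). if r \<le> 1/2 then f (2 * r, p) else g (2 * r - 1, p))"

definition pi3 :: "'a topology \<Rightarrow> 'a \<Rightarrow> (real \<times> real \<times> real \<Rightarrow> 'a) set monoid" where
  "pi3 X x0 =
     \<lparr>carrier = cube_class X x0 ` cube_maps X x0,
      mult = (\<lambda>A B. \<Union>f\<in>A. \<Union>g\<in>B. cube_class X x0 (cube_concat f g)),
      one = cube_class X x0 (\<lambda>_. x0)\<rparr>"

lemma cube_homotopic_refl: "cube_homotopic X x0 f f \<longleftrightarrow> f \<in> cube_maps X x0"
  by (simp add: cube_homotopic_def cube_maps_def)

lemma cube_homotopic_sym: "cube_homotopic X x0 f g \<Longrightarrow> cube_homotopic X x0 g f"
  unfolding cube_homotopic_def by (rule homotopic_with_symD)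

lemma cube_homotopic_trans [trans]:
  "cube_homotopic X x0 f g \<Longrightarrow> cube_homotopic X x0 g h \<Longrightarrow> cube_homotopic X x0 f h"
  unfolding cube_homotopic_def by (rule homotopic_with_trans)

lemma cube_homotopic_imp_maps:
  assumes "cube_homotopic X x0 f g" shows "f \<in> cube_maps X x0" "g \<in> cube_maps X x0"
  using homotopic_with_imp_continuous_maps[OF assms[unfolded cube_homotopic_def]]
    homotopic_with_imp_property[OF assms[unfolded cube_homotopic_def]]
  by (auto simp: cube_maps_def)

lemma cube_class_eq_iff:
  assumes "f \<in> cube_maps X x0"
  shows "cube_class X x0 f = cube_class X x0 g \<longleftrightarrow> cube_homotopic X x0 f g"
proof
  assume eq: "cube_class X x0 f = cube_class X x0 g"
  have "f \<in> cube_class X x0 f" using assms by (simp add: cube_class_def cube_homotopic_refl)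
  then show "cube_homotopic X x0 f g"
    using eq by (auto simp: cube_class_def intro: cube_homotopic_sym)
next
  assume "cube_homotopic X x0 f g"
  then show "cube_class X x0 f = cube_class X x0 g"
    by (auto simp: cube_class_def intro: cube_homotopic_sym cube_homotopic_trans)
qed

text \<open>Reparametrising the first coordinate does not change the class.\<close>

lemma cube_homotopic_reparam:
  assumes f: "f \<in> cube_maps X x0"
    and a: "continuous_on {0..1} a" "a \<in> {0..1} \<rightarrow> {0..1}" "a 0 \<in> {0, 1}" "a 1 \<in> {0, 1}"
    and b: "continuous_on {0..1} b" "b \<in> {0..1} \<rightarrow> {0..1}" "b 0 = a 0" "b 1 = a (1::real)"
    and eq: "\<And>r p. (r, p) \<in> cube3 \<Longrightarrow> f1 (r, p) = f (a r, p)" "\<And>r p. (r, p) \<in> cube3 \<Longrightarrow> f2 (r, p) = f (b r, p)"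
  shows "cube_homotopic X x0 f1 f2"
proof -
  define \<Phi> where "\<Phi> = (\<lambda>(u::real, r, p::real \<times> real). ((1 - u) * a r + u * b r, p))"
  have conv: "(1 - u) * a r + u * b r \<in> {0..1}" if "u \<in> {0..1}" "r \<in> {0..1}" for u r
  proof -
    have ar: "a r \<in> {0..1}" "b r \<in> {0..1}" using a(2) b(2) that by auto
    show ?thesis using convexD_alt[of "{0..1::real}" "a r" "b r" u] ar that by simp
  qed
  have cont\<Phi>: "continuous_on ({0..1} \<times> cube3) \<Phi>"
  proof -
    have A: "continuous_on ({0..1} \<times> cube3) (\<lambda>x. a (fst (snd x)))"
      by (rule continuous_on_compose2[OF a(1)]) (auto intro!: continuous_intros simp: cube3_def)
    have B: "continuous_on ({0..1} \<times> cube3) (\<lambda>x. b (fst (snd x)))"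
      by (rule continuous_on_compose2[OF b(1)]) (auto intro!: continuous_intros simp: cube3_def)
    show ?thesis unfolding \<Phi>_def case_prod_beta by (intro continuous_intros A B)
  qed
  have \<Phi>cube: "\<Phi> x \<in> cube3" if "x \<in> {0..1} \<times> cube3" for x
    using that conv by (auto simp: \<Phi>_def cube3_def)
  have \<Phi>bd: "\<Phi> (u, p) \<in> cube3_boundary" if "u \<in> {0..1}" "p \<in> cube3_boundary" for u p
  proof -
    obtain r s t where p: "p = (r, s, t)" by (cases p) auto
    have "\<Phi> (u, p) \<in> cube3" using that by (intro \<Phi>cube) (auto simp: cube3_boundary_def)
    moreover have "(1 - u) * a r + u * b r \<in> {0, 1}" if "r \<in> {0, 1}"
    proof -
      have "(1 - u) * a r + u * b r = a r" using b that by (auto simp: algebra_simps)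
      then show ?thesis using a that by auto
    qed
    ultimately show ?thesis
      using that p by (auto simp: \<Phi>_def cube3_boundary_def)
  qed
  have P: "top_of_set ({0..1} \<times> cube3) = prod_topology (top_of_set {0..1::real}) (top_of_set cube3)"
    by (simp add: prod_topology_subtopology_eu)
  have "homotopic_with (\<lambda>k. \<forall>p\<in>cube3_boundary. k p = x0) (top_of_set cube3) X
          (\<lambda>p. f (\<Phi> (0, p))) (\<lambda>p. f (\<Phi> (1, p)))"
    unfolding homotopic_with_def
  proof (intro exI conjI allI ballI)
    have "continuous_map (top_of_set ({0..1} \<times> cube3)) (top_of_set cube3) \<Phi>"
      using cont\<Phi> \<Phi>cube by auto
    then have "continuous_map (top_of_set ({0..1} \<times> cube3)) X (f \<circ> \<Phi>)"
      using f unfolding cube_maps_def by (blast intro: continuous_map_compose)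
    then show "continuous_map (prod_topology (top_of_set {0..1::real}) (top_of_set cube3)) X (f \<circ> \<Phi>)"
      by (simp only: P)
    show "(f \<circ> \<Phi>) (u, p) = x0" if "u \<in> {0..1}" "p \<in> cube3_boundary" for u p
      using \<Phi>bd[OF that] f by (simp add: cube_maps_def)
  qed auto
  then show ?thesis
    unfolding cube_homotopic_def
  proof (rule homotopic_with_eq)
    fix x assume "x \<in> topspace (top_of_set cube3)"
    then show "f1 x = f (\<Phi> (0, x))" "f2 x = f (\<Phi> (1, x))"
      using eq by (cases x; simp add: \<Phi>_def)+
  next
    fix h k :: "real \<times> real \<times> real \<Rightarrow> 'a"
    assume "\<And>x. x \<in> topspace (top_of_set cube3) \<Longrightarrow> h x = k x"
    then show "(\<forall>p\<in>cube3_boundary. h p = x0) \<longleftrightarrow> (\<forall>p\<in>cube3_boundary. k p = x0)"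
      by (auto simp: cube3_boundary_def)
  qed
qed

lemma cube_concat_homotopic:
  assumes f: "cube_homotopic X x0 f f'" and g: "cube_homotopic X x0 g g'"
  shows "cube_homotopic X x0 (cube_concat f g) (cube_concat f' g')"
proof -
  let ?T = "prod_topology (top_of_set {0..1::real}) (top_of_set cube3)"
  obtain h where h: "continuous_map ?T X h" "\<And>x. h (0, x) = f x" "\<And>x. h (1, x) = f' x"
    "\<And>u p. u \<in> {0..1} \<Longrightarrow> p \<in> cube3_boundary \<Longrightarrow> h (u, p) = x0"
    using f unfolding cube_homotopic_def homotopic_with_def by blast
  obtain k where k: "continuous_map ?T X k" "\<And>x. k (0, x) = g x" "\<And>x. k (1, x) = g' x"
    "\<And>u p. u \<in> {0..1} \<Longrightarrow> p \<in> cube3_boundary \<Longrightarrow> k (u, p) = x0"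
    using g unfolding cube_homotopic_def homotopic_with_def by blast
  have P: "?T = top_of_set ({0..1} \<times> cube3)" by (simp add: prod_topology_subtopology_eu)
  define L where "L = (\<lambda>(u::real, r::real, p::real \<times> real). (u, 2 * r, p))"
  define R where "R = (\<lambda>(u::real, r::real, p::real \<times> real). (u, 2 * r - 1, p))"
  define H where "H = (\<lambda>x. if fst (snd x) \<le> 1/2 then (h \<circ> L) x else (k \<circ> R) x)"
  have contH: "continuous_map ?T X H"
    unfolding H_def
  proof (rule continuous_map_cases_le)
    show "continuous_map ?T euclideanreal (\<lambda>x. fst (snd x))"
      unfolding P by (auto intro!: continuous_intros)
    show "continuous_map ?T euclideanreal (\<lambda>x. 1/2)" by simp
    show "continuous_map (subtopology ?T {x \<in> topspace ?T. fst (snd x) \<le> 1/2}) X (h \<circ> L)"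
      by (rule continuous_map_compose[OF _ h(1)], unfold P subtopology_subtopology)
         (auto simp: L_def cube3_def case_prod_beta intro!: continuous_intros)
    show "continuous_map (subtopology ?T {x \<in> topspace ?T. 1/2 \<le> fst (snd x)}) X (k \<circ> R)"
      by (rule continuous_map_compose[OF _ k(1)], unfold P subtopology_subtopology)
         (auto simp: R_def cube3_def case_prod_beta intro!: continuous_intros)
    fix x assume x: "x \<in> topspace ?T" "fst (snd x) = 1/2"
    then obtain u p where u: "x = (u, 1/2, p)" "u \<in> {0..1}" "p \<in> {0..1} \<times> {0..1}"
      by (cases x) (auto simp: cube3_def)
    have "(1, p) \<in> cube3_boundary" "(0, p) \<in> cube3_boundary"
      using u by (auto simp: cube3_boundary_def cube3_def)
    then show "(h \<circ> L) x = (k \<circ> R) x" using h(4) k(4) u by (simp add: L_def R_def)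
  qed
  show ?thesis
    unfolding cube_homotopic_def homotopic_with_def
  proof (rule exI[of _ H], intro conjI allI ballI)
    show "continuous_map ?T X H" by (rule contH)
    show "H (0, x) = cube_concat f g x" for x
      by (cases x) (simp add: H_def L_def R_def cube_concat_def h k)
    show "H (1, x) = cube_concat f' g' x" for x
      by (cases x) (simp add: H_def L_def R_def cube_concat_def h k)
    fix u :: real and p assume u: "u \<in> {0..1}" and p: "p \<in> cube3_boundary"
    obtain r q where rq: "p = (r, q)" by (cases p)
    show "H (u, p) = x0"
    proof (cases "r \<le> 1/2")
      case True
      then have "(2 * r, q) \<in> cube3_boundary"
        using p rq by (cases q) (auto simp: cube3_boundary_def cube3_def)
      then show ?thesis using True h(4) u rq by (simp add: H_def L_def)
    next
      case False
      then have "(2 * r - 1, q) \<in> cube3_boundary"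
        using p rq by (cases q) (auto simp: cube3_boundary_def cube3_def)
      then show ?thesis using False k(4) u rq by (simp add: H_def R_def)
    qed
  qed
qed

lemma cube_concat_in:
  "f \<in> cube_maps X x0 \<Longrightarrow> g \<in> cube_maps X x0 \<Longrightarrow> cube_concat f g \<in> cube_maps X x0"
  using cube_concat_homotopic[of X x0 f f g g] by (simp add: cube_homotopic_refl)

lemma UN2_const:
  assumes "\<And>a b. a \<in> A \<Longrightarrow> b \<in> B \<Longrightarrow> F a b = C" "a \<in> A" "b \<in> B"
  shows "(\<Union>a\<in>A. \<Union>b\<in>B. F a b) = C"
proof -
  have "(\<Union>a\<in>A. \<Union>b\<in>B. F a b) = (\<Union>a\<in>A. \<Union>b\<in>B. C)"
    using assms(1) by simp
  then show ?thesis using assms(2,3) by auto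
qed

lemma pi3_mult:
  assumes "f \<in> cube_maps X x0" "g \<in> cube_maps X x0"
  shows "cube_class X x0 f \<otimes>\<^bsub>pi3 X x0\<^esub> cube_class X x0 g = cube_class X x0 (cube_concat f g)"
proof -
  have "cube_class X x0 (cube_concat f' g') = cube_class X x0 (cube_concat f g)"
    if "f' \<in> cube_class X x0 f" "g' \<in> cube_class X x0 g" for f' g'
  proof -
    have "cube_homotopic X x0 (cube_concat f g) (cube_concat f' g')"
      using that by (intro cube_concat_homotopic) (simp_all add: cube_class_def)
    then show ?thesis
      using cube_class_eq_iff[OF cube_concat_in[OF assms]] by blast
  qed
  moreover have "f \<in> cube_class X x0 f" "g \<in> cube_class X x0 g"
    using assms by (simp_all add: cube_class_def cube_homotopic_refl)
  ultimately have "(\<Union>f'\<in>cube_class X x0 f. \<Union>g'\<in>cube_class X x0 g. cube_class X x0 (cube_concat f' g'))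
      = cube_class X x0 (cube_concat f g)"
    by (rule UN2_const)
  then show ?thesis by (simp add: pi3_def)
qed

theorem group_pi3:
  assumes "x0 \<in> topspace X"
  shows "group (pi3 X x0)"
proof -
  let ?c = "cube_class X x0"
  have e: "(\<lambda>_. x0) \<in> cube_maps X x0" using assms by (simp add: cube_maps_def)
  have [simp]: "one (pi3 X x0) = ?c (\<lambda>_. x0)" "carrier (pi3 X x0) = ?c ` cube_maps X x0"
    by (simp_all add: pi3_def)
  have bd0: "f (0, p) = x0" "f (1, p) = x0" if "f \<in> cube_maps X x0" "p \<in> {0..1} \<times> {0..1}" for f p
    using that by (auto simp: cube_maps_def cube3_boundary_def cube3_def)
  show ?thesis
  proof (rule groupI)
    fix A B assume "A \<in> carrier (pi3 X x0)" "B \<in> carrier (pi3 X x0)"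
    then show "A \<otimes>\<^bsub>pi3 X x0\<^esub> B \<in> carrier (pi3 X x0)"
      by (auto simp: pi3_mult cube_concat_in)
  next
    show "one (pi3 X x0) \<in> carrier (pi3 X x0)" using e by auto
  next
    fix A B C assume "A \<in> carrier (pi3 X x0)" "B \<in> carrier (pi3 X x0)" "C \<in> carrier (pi3 X x0)"
    then obtain f g h where fgh: "f \<in> cube_maps X x0" "g \<in> cube_maps X x0" "h \<in> cube_maps X x0"
      "A = ?c f" "B = ?c g" "C = ?c h" by auto
    have cont: "continuous_on {0..1} (\<lambda>r::real. max (r / 2) (max (min (r - 1/4) (1/2)) (2 * r - 1)))"
      by (intro continuous_intros) auto
    have maps: "(\<lambda>r::real. max (r / 2) (max (min (r - 1/4) (1/2)) (2 * r - 1))) \<in> {0..1} \<rightarrow> {0..1}"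
      by auto
    have "cube_homotopic X x0 (cube_concat (cube_concat f g) h) (cube_concat f (cube_concat g h))"
    proof (rule cube_homotopic_reparam[where f = "cube_concat (cube_concat f g) h" and a = "\<lambda>r. r"
          and b = "\<lambda>r. max (r / 2) (max (min (r - 1/4) (1/2)) (2 * r - 1))"])
      fix r :: real and p assume "(r, p) \<in> cube3"
      show "cube_concat f (cube_concat g h) (r, p)
         = cube_concat (cube_concat f g) h (max (r / 2) (max (min (r - 1/4) (1/2)) (2 * r - 1)), p)"
      proof -
        consider "r \<le> 1/2" | "1/2 < r" "r \<le> 3/4" | "3/4 < r" by linarith
        then show ?thesis
        proof cases
          case 1
          then have "max (r / 2) (max (min (r - 1/4) (1/2)) (2 * r - 1)) = r / 2" by (simp add: max_def min_def)
          then show ?thesis using 1 by (simp add: cube_concat_def)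
        next
          case 2
          then have "max (r / 2) (max (min (r - 1/4) (1/2)) (2 * r - 1)) = r - 1/4" by (simp add: max_def min_def)
          then show ?thesis using 2 by (simp add: cube_concat_def algebra_simps)
        next
          case 3
          then have "max (r / 2) (max (min (r - 1/4) (1/2)) (2 * r - 1)) = 2 * r - 1" by (simp add: max_def min_def)
          then show ?thesis using 3 by (simp add: cube_concat_def algebra_simps)
        qed
      qed
    qed (use cont maps in \<open>simp_all add: cube_concat_in fgh\<close>)
    then show "A \<otimes>\<^bsub>pi3 X x0\<^esub> B \<otimes>\<^bsub>pi3 X x0\<^esub> C = A \<otimes>\<^bsub>pi3 X x0\<^esub> (B \<otimes>\<^bsub>pi3 X x0\<^esub> C)"
      using fgh by (simp add: pi3_mult cube_concat_in cube_class_eq_iff)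
  next
    fix A assume "A \<in> carrier (pi3 X x0)"
    then obtain f where f: "f \<in> cube_maps X x0" "A = ?c f" by auto
    have end0: "f (0, p) = x0" "f (1, p) = x0" if "(r, p) \<in> cube3" for r p
      using that bd0[OF f(1)] by (auto simp: cube3_def)
    have "continuous_on {0..1} (\<lambda>r::real. max 0 (2 * r - 1))"
      by (intro continuous_intros)
    moreover have "(\<lambda>r::real. max 0 (2 * r - 1)) \<in> {0..1} \<rightarrow> {0..1}" by auto
    moreover have "cube_concat (\<lambda>_. x0) f (r, p) = f (max 0 (2 * r - 1), p)" if "(r, p) \<in> cube3" for r p
      using end0[OF that] by (cases r "1/2::real" rule: linorder_cases) (simp_all add: cube_concat_def)
    ultimately have "cube_homotopic X x0 (cube_concat (\<lambda>_. x0) f) f"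
      by (intro cube_homotopic_reparam[where f = f and a = "\<lambda>r. max 0 (2 * r - 1)" and b = "\<lambda>r. r"])
         (simp_all add: f)
    then show "one (pi3 X x0) \<otimes>\<^bsub>pi3 X x0\<^esub> A = A"
      using f e by (simp add: pi3_mult cube_concat_in cube_class_eq_iff)
    define g where "g = (\<lambda>(r, p). f (1 - r, p))"
    have "continuous_on {0..1} (\<lambda>r::real. 1 - r)" by (intro continuous_intros)
    then have "cube_homotopic X x0 g g"
      by (intro cube_homotopic_reparam[where f = f and a = "\<lambda>r. 1 - r" and b = "\<lambda>r. 1 - r"])
         (simp_all add: f g_def)
    then have g: "g \<in> cube_maps X x0" by (simp add: cube_homotopic_refl)
    have "continuous_on {0..1} (\<lambda>r::real. max (1 - 2 * r) (2 * r - 1))"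
      by (intro continuous_intros)
    moreover have "(\<lambda>r::real. max (1 - 2 * r) (2 * r - 1)) \<in> {0..1} \<rightarrow> {0..1}" by auto
    moreover have "cube_concat g f (r, p) = f (max (1 - 2 * r) (2 * r - 1), p)" for r p
      by (cases r "1/2::real" rule: linorder_cases) (simp_all add: cube_concat_def g_def)
    ultimately have "cube_homotopic X x0 (cube_concat g f) (\<lambda>_. x0)"
      by (intro cube_homotopic_reparam[where f = f and a = "\<lambda>r. max (1 - 2 * r) (2 * r - 1)"
            and b = "\<lambda>r. 1"]) (simp_all add: f end0)
    then show "\<exists>B\<in>carrier (pi3 X x0). B \<otimes>\<^bsub>pi3 X x0\<^esub> A = one (pi3 X x0)"
      using f g e by (intro bexI[of _ "?c g"]) (auto simp: pi3_mult cube_concat_in cube_class_eq_iff)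
  qed
qed


section \<open>The homotopy classes of the multiples of the Hopf map\<close>

text \<open>A map that presents \<^term>\<open>S3\<close> as the cube with its boundary collapsed to the point \<open>(1, 0)\<close>:
  with \<open>y = 2t - 1 \<in> [-1, 1]\<^sup>3\<close> and \<open>d = \<Prod>(1 - y\<^sub>i\<^sup>2)\<close>, the point \<open>t\<close> is sent to the inverse
  stereographic projection (from \<open>(1, 0)\<close>) of \<open>y / d \<in> \<real>\<^sup>3\<close>.\<close>

definition sphere_base :: "complex \<times> complex" where
  "sphere_base = (1, 0)"

definition cube_collapse :: "real \<times> real \<times> real \<Rightarrow> complex \<times> complex" where
  "cube_collapse = (\<lambda>(t1, t2, t3).
     let y1 = 2 * t1 - 1; y2 = 2 * t2 - 1; y3 = 2 * t3 - 1;
         d = (1 - y1\<^sup>2) * (1 - y2\<^sup>2) * (1 - y3\<^sup>2);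
         q = y1\<^sup>2 + y2\<^sup>2 + y3\<^sup>2
     in (Complex ((q - d\<^sup>2) / (q + d\<^sup>2)) (2 * d * y1 / (q + d\<^sup>2)),
         Complex (2 * d * y2 / (q + d\<^sup>2)) (2 * d * y3 / (q + d\<^sup>2))))"

definition collapse_height :: "real \<Rightarrow> real \<Rightarrow> real \<Rightarrow> real" where
  "collapse_height y1 y2 y3 = (1 - y1\<^sup>2) * (1 - y2\<^sup>2) * (1 - y3\<^sup>2)"

lemma cube_collapse_eq:
  fixes t1 t2 t3 :: real
  defines "y1 \<equiv> 2 * t1 - 1" and "y2 \<equiv> 2 * t2 - 1" and "y3 \<equiv> 2 * t3 - 1"
  defines "d \<equiv> collapse_height y1 y2 y3" and "q \<equiv> y1\<^sup>2 + y2\<^sup>2 + y3\<^sup>2"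
  shows "cube_collapse (t1, t2, t3) =
     (Complex ((q - d\<^sup>2) / (q + d\<^sup>2)) (2 * d * y1 / (q + d\<^sup>2)),
      Complex (2 * d * y2 / (q + d\<^sup>2)) (2 * d * y3 / (q + d\<^sup>2)))"
  by (simp add: cube_collapse_def Let_def assms collapse_height_def)

lemma collapse_denom_pos: "y1\<^sup>2 + y2\<^sup>2 + y3\<^sup>2 + (collapse_height y1 y2 y3)\<^sup>2 > 0"
proof (cases "y1 = 0 \<and> y2 = 0 \<and> y3 = 0")
  case True
  then show ?thesis by (simp add: collapse_height_def)
next
  case False
  then have "y1\<^sup>2 > 0 \<or> y2\<^sup>2 > 0 \<or> y3\<^sup>2 > 0" by simp
  then show ?thesis
    using zero_le_power2[of y1] zero_le_power2[of y2] zero_le_power2[of y3]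
      zero_le_power2[of "collapse_height y1 y2 y3"] by linarith
qed

lemma collapse_height_nonneg:
  assumes "y1\<^sup>2 \<le> 1" "y2\<^sup>2 \<le> 1" "y3\<^sup>2 \<le> 1" shows "collapse_height y1 y2 y3 \<ge> 0"
  using assms by (simp add: collapse_height_def)

lemma collapse_height_antimono:
  assumes "y1\<^sup>2 \<le> z1\<^sup>2" "y2\<^sup>2 \<le> z2\<^sup>2" "y3\<^sup>2 \<le> z3\<^sup>2" "z1\<^sup>2 \<le> 1" "z2\<^sup>2 \<le> 1" "z3\<^sup>2 \<le> 1"
  shows "collapse_height z1 z2 z3 \<le> collapse_height y1 y2 y3"
  unfolding collapse_height_def using assms
  by (intro mult_mono mult_nonneg_nonneg) auto

lemma continuous_on_cube_collapse: "continuous_on S cube_collapse"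
proof -
  have pos: "(2 * t1 - 1)\<^sup>2 + (2 * t2 - 1)\<^sup>2 + (2 * t3 - 1)\<^sup>2 +
    ((1 - (2 * t1 - 1)\<^sup>2) * (1 - (2 * t2 - 1)\<^sup>2) * (1 - (2 * t3 - 1)\<^sup>2))\<^sup>2 \<noteq> 0" for t1 t2 t3 :: real
    using collapse_denom_pos[of "2 * t1 - 1" "2 * t2 - 1" "2 * t3 - 1"]
    by (simp add: collapse_height_def)
  have "continuous_on S (\<lambda>x. cube_collapse (fst x, fst (snd x), snd (snd x)))"
    unfolding cube_collapse_def prod.case Let_def Complex_eq
    by (intro continuous_intros ballI pos)
  then show ?thesis by simp
qed

lemma cube_collapse_in_sphere: "cube_collapse p \<in> sphere 0 1"
proof -
  obtain t1 t2 t3 where p: "p = (t1, t2, t3)" by (cases p) auto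
  define y1 y2 y3 where y: "y1 = 2 * t1 - 1" "y2 = 2 * t2 - 1" "y3 = 2 * t3 - 1"
  define d where "d = collapse_height y1 y2 y3"
  define q where "q = y1\<^sup>2 + y2\<^sup>2 + y3\<^sup>2"
  have N: "q + d\<^sup>2 \<noteq> 0" using collapse_denom_pos[of y1 y2 y3] by (simp add: q_def d_def)
  have "(q - d\<^sup>2)\<^sup>2 + (2 * d * y1)\<^sup>2 + ((2 * d * y2)\<^sup>2 + (2 * d * y3)\<^sup>2) = (q + d\<^sup>2)\<^sup>2"
    unfolding q_def by algebra
  then have "((q - d\<^sup>2) / (q + d\<^sup>2))\<^sup>2 + (2 * d * y1 / (q + d\<^sup>2))\<^sup>2
      + ((2 * d * y2 / (q + d\<^sup>2))\<^sup>2 + (2 * d * y3 / (q + d\<^sup>2))\<^sup>2) = 1"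
    using N by (simp only: power_divide add_divide_distrib[symmetric]) simp
  then show ?thesis
    unfolding in_sphere_complex_pair p cube_collapse_eq
    by (simp add: cmod_power2 y d_def q_def)
qed

lemma cube3_coord: "t \<in> {0..1::real} \<Longrightarrow> (2 * t - 1)\<^sup>2 \<le> 1"
  by (auto simp: abs_square_le_1)

lemma cube_collapse_eq_base_iff:
  assumes "p \<in> cube3"
  shows "cube_collapse p = sphere_base \<longleftrightarrow> p \<in> cube3_boundary"
proof -
  obtain t1 t2 t3 where p: "p = (t1, t2, t3)" by (cases p) auto
  define y1 y2 y3 where y: "y1 = 2 * t1 - 1" "y2 = 2 * t2 - 1" "y3 = 2 * t3 - 1"
  define d where "d = collapse_height y1 y2 y3"
  define q where "q = y1\<^sup>2 + y2\<^sup>2 + y3\<^sup>2"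
  have N: "q + d\<^sup>2 \<noteq> 0" using collapse_denom_pos[of y1 y2 y3] by (simp add: q_def d_def)
  have c: "cube_collapse p =
     (Complex ((q - d\<^sup>2) / (q + d\<^sup>2)) (2 * d * y1 / (q + d\<^sup>2)),
      Complex (2 * d * y2 / (q + d\<^sup>2)) (2 * d * y3 / (q + d\<^sup>2)))"
    by (simp only: p cube_collapse_eq d_def q_def y)
  have "cube_collapse p = sphere_base \<longleftrightarrow> d = 0"
  proof
    assume "cube_collapse p = sphere_base"
    then have "Re (fst (cube_collapse p)) = 1" by (simp add: sphere_base_def)
    then have "(q - d\<^sup>2) / (q + d\<^sup>2) = 1" unfolding c fst_conv complex.sel .
    then show "d = 0" using N by (simp add: field_simps)
  next
    assume d: "d = 0"
    then have "q \<noteq> 0" using N by simp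
    then show "cube_collapse p = sphere_base"
      unfolding c sphere_base_def d by (simp add: complex_eq_iff)
  qed
  also have "\<dots> \<longleftrightarrow> p \<in> cube3_boundary"
  proof -
    have "(2 * t - 1)\<^sup>2 = 1 \<longleftrightarrow> t \<in> {0, 1}" for t :: real
      by (auto simp: power2_eq_1_iff)
    then have "1 - (2 * t - 1)\<^sup>2 = 0 \<longleftrightarrow> t \<in> {0, 1}" for t :: real
      by (metis diff_eq_eq add_0 eq_commute)
    then show ?thesis
      using assms unfolding d_def collapse_height_def y p cube3_boundary_def by simp
  qed
  finally show ?thesis .
qed

lemma collapse_radial:
  fixes s :: real
  assumes "s \<ge> 1" "z1 = s * y1" "z2 = s * y2" "z3 = s * y3" "z1\<^sup>2 \<le> 1" "z2\<^sup>2 \<le> 1" "z3\<^sup>2 \<le> 1"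
    "collapse_height z1 z2 z3 = s * collapse_height y1 y2 y3" "collapse_height y1 y2 y3 > 0"
  shows "s = 1"
proof -
  have "y\<^sup>2 \<le> (s * y)\<^sup>2" for y
  proof -
    have "1 * y\<^sup>2 \<le> s\<^sup>2 * y\<^sup>2"
      by (rule mult_right_mono) (use assms(1) in \<open>simp_all add: one_le_power\<close>)
    then show ?thesis by (simp add: power_mult_distrib)
  qed
  then have "s * collapse_height y1 y2 y3 \<le> 1 * collapse_height y1 y2 y3"
    using collapse_height_antimono[of y1 z1 y2 z2 y3 z3] assms by simp
  then have "s \<le> 1" using assms(9) by (simp only: mult_le_cancel_right_pos)
  then show ?thesis using assms(1) by simp
qed

lemma inj_on_cube_collapse: "inj_on cube_collapse (cube3 - cube3_boundary)"
proof (rule inj_onI)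
  fix p p' assume p: "p \<in> cube3 - cube3_boundary" and p': "p' \<in> cube3 - cube3_boundary"
    and eq: "cube_collapse p = cube_collapse p'"
  obtain t1 t2 t3 where t: "p = (t1, t2, t3)" by (cases p) auto
  obtain t1' t2' t3' where t': "p' = (t1', t2', t3')" by (cases p') auto
  have key: "\<exists>d > 0. \<exists>N > 0. d = collapse_height (2 * t1 - 1) (2 * t2 - 1) (2 * t3 - 1) \<and>
      1 - Re (fst (cube_collapse (t1, t2, t3))) = 2 * d\<^sup>2 / N \<and>
      Im (fst (cube_collapse (t1, t2, t3))) = 2 * d * (2 * t1 - 1) / N \<and>
      Re (snd (cube_collapse (t1, t2, t3))) = 2 * d * (2 * t2 - 1) / N \<and>
      Im (snd (cube_collapse (t1, t2, t3))) = 2 * d * (2 * t3 - 1) / N"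
    if int: "(t1, t2, t3) \<in> cube3 - cube3_boundary" for t1 t2 t3 :: real
  proof -
    let ?d = "collapse_height (2 * t1 - 1) (2 * t2 - 1) (2 * t3 - 1)"
    let ?q = "(2 * t1 - 1)\<^sup>2 + (2 * t2 - 1)\<^sup>2 + (2 * t3 - 1)\<^sup>2"
    let ?N = "?q + ?d\<^sup>2"
    have N: "?N > 0" by (rule collapse_denom_pos)
    have sq: "(2 * t1 - 1)\<^sup>2 \<le> 1" "(2 * t2 - 1)\<^sup>2 \<le> 1" "(2 * t3 - 1)\<^sup>2 \<le> 1"
      using int by (auto simp: cube3_def intro!: cube3_coord)
    have ge: "?d \<ge> 0" by (rule collapse_height_nonneg[OF sq])
    have c: "cube_collapse (t1, t2, t3) =
       (Complex ((?q - ?d\<^sup>2) / ?N) (2 * ?d * (2 * t1 - 1) / ?N),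
        Complex (2 * ?d * (2 * t2 - 1) / ?N) (2 * ?d * (2 * t3 - 1) / ?N))"
      by (rule cube_collapse_eq)
    have "?d \<noteq> 0"
    proof
      assume d: "?d = 0"
      have "cube_collapse (t1, t2, t3) = sphere_base"
        using N unfolding c d sphere_base_def by (simp add: complex_eq_iff)
      then show False using cube_collapse_eq_base_iff int by blast
    qed
    then have d: "?d > 0" using ge by linarith
    have "1 - (?q - ?d\<^sup>2) / ?N = 2 * ?d\<^sup>2 / ?N"
      using N by (simp add: field_simps)
    then show ?thesis
      by (intro exI[of _ ?d] exI[of _ ?N] conjI) (use d N c in simp_all)
  qed
  define y1 y2 y3 where y: "y1 = 2 * t1 - 1" "y2 = 2 * t2 - 1" "y3 = 2 * t3 - 1"
  define z1 z2 z3 where z: "z1 = 2 * t1' - 1" "z2 = 2 * t2' - 1" "z3 = 2 * t3' - 1"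
  have sq: "y1\<^sup>2 \<le> 1" "y2\<^sup>2 \<le> 1" "y3\<^sup>2 \<le> 1" "z1\<^sup>2 \<le> 1" "z2\<^sup>2 \<le> 1" "z3\<^sup>2 \<le> 1"
    using p p' t t' unfolding y z by (auto simp: cube3_def intro!: cube3_coord)
  obtain d N where d: "d > 0" "N > 0" "d = collapse_height y1 y2 y3"
    "1 - Re (fst (cube_collapse p)) = 2 * d\<^sup>2 / N" "Im (fst (cube_collapse p)) = 2 * d * y1 / N"
    "Re (snd (cube_collapse p)) = 2 * d * y2 / N" "Im (snd (cube_collapse p)) = 2 * d * y3 / N"
    using key[OF p[unfolded t]] unfolding t[symmetric] y by blast
  obtain e M where e: "e > 0" "M > 0" "e = collapse_height z1 z2 z3"
    "1 - Re (fst (cube_collapse p')) = 2 * e\<^sup>2 / M" "Im (fst (cube_collapse p')) = 2 * e * z1 / M"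
    "Re (snd (cube_collapse p')) = 2 * e * z2 / M" "Im (snd (cube_collapse p')) = 2 * e * z3 / M"
    using key[OF p'[unfolded t']] unfolding t'[symmetric] z by blast
  have ratio: "(2 * d * a / N) / (2 * d\<^sup>2 / N) = a / d" "(2 * e * a / M) / (2 * e\<^sup>2 / M) = a / e" for a
    using d(1,2) e(1,2) by (simp_all add: power2_eq_square)
  have r: "y1 / d = z1 / e" "y2 / d = z2 / e" "y3 / d = z3 / e"
    unfolding ratio[symmetric] d(4-7)[symmetric] e(4-7)[symmetric] eq by simp_all
  define s where "s = e / d"
  have s: "z1 = s * y1" "z2 = s * y2" "z3 = s * y3" "e = s * d" "s > 0"
    using r d(1) e(1) by (simp_all add: s_def field_simps)
  then have s': "y1 = inverse s * z1" "y2 = inverse s * z2" "y3 = inverse s * z3" "d = inverse s * e"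
    by simp_all
  have "s = 1"
  proof (cases "s \<ge> 1")
    case True
    show ?thesis
      by (rule collapse_radial[OF True s(1-3) sq(4-6)]) (use s d e in auto)
  next
    case False
    then have "inverse s \<ge> 1" using s(5) by (simp add: one_le_inverse)
    then have "inverse s = 1"
      by (rule collapse_radial[OF _ s'(1-3) sq(1-3)]) (use s' d e in auto)
    then show ?thesis by simp
  qed
  then show "p = p'" using s t t' by (simp add: y z)
qed

lemma cube_collapse_surj:
  assumes "x \<in> sphere 0 1" shows "x \<in> cube_collapse ` cube3"
proof (cases "x = sphere_base")
  case True
  have "(0, 0, 0) \<in> cube3_boundary" "(0, 0, 0) \<in> cube3" by (auto simp: cube3_boundary_def cube3_def)
  then have "cube_collapse (0, 0, 0) = x" "(0, 0, 0) \<in> cube3"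
    using cube_collapse_eq_base_iff True by auto
  then show ?thesis by blast
next
  case False
  obtain x1 x2 x3 x4 where x: "x = (Complex x1 x2, Complex x3 x4)"
    by (metis complex.collapse prod.collapse)
  have n: "x1\<^sup>2 + x2\<^sup>2 + (x3\<^sup>2 + x4\<^sup>2) = 1"
    using in_sphere_complex_pair[THEN iffD1, OF assms] by (simp add: x cmod_power2)
  have x1: "x1 < 1"
  proof (rule ccontr)
    assume "\<not> x1 < 1"
    then have "x1\<^sup>2 \<ge> 1" by (simp add: one_le_power)
    then have "x1\<^sup>2 = 1" "x2\<^sup>2 = 0" "x3\<^sup>2 = 0" "x4\<^sup>2 = 0"
      using n zero_le_power2[of x2] zero_le_power2[of x3] zero_le_power2[of x4] by linarith+
    then show False using False \<open>\<not> x1 < 1\<close> by (auto simp: x sphere_base_def complex_eq_iff power2_eq_1_iff)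
  qed
  define u1 u2 u3 where u: "u1 = x2 / (1 - x1)" "u2 = x3 / (1 - x1)" "u3 = x4 / (1 - x1)"
  have ux: "x2 = u1 * (1 - x1)" "x3 = u2 * (1 - x1)" "x4 = u3 * (1 - x1)"
    using x1 by (simp_all add: u)
  have unorm: "u1\<^sup>2 + u2\<^sup>2 + u3\<^sup>2 = (1 + x1) / (1 - x1)"
  proof -
    have "(u1\<^sup>2 + u2\<^sup>2 + u3\<^sup>2) * (1 - x1)\<^sup>2 = 1 - x1\<^sup>2"
      using n unfolding ux power_mult_distrib by (simp only: distrib_right)
    also have "\<dots> = (1 + x1) * (1 - x1)" by (simp add: power2_eq_square algebra_simps)
    finally have "(u1\<^sup>2 + u2\<^sup>2 + u3\<^sup>2) * (1 - x1) = 1 + x1"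
      using x1 unfolding power2_eq_square[of "1 - x1"] mult.assoc[symmetric] by simp
    then show ?thesis using x1 by (simp only: eq_divide_eq) simp
  qed
  define M where "M = max \<bar>u1\<bar> (max \<bar>u2\<bar> \<bar>u3\<bar>)"
  have M: "\<bar>u1\<bar> \<le> M" "\<bar>u2\<bar> \<le> M" "\<bar>u3\<bar> \<le> M" "M = \<bar>u1\<bar> \<or> M = \<bar>u2\<bar> \<or> M = \<bar>u3\<bar>"
    by (auto simp: M_def max_def)
  have "\<exists>s > 0. s * M \<le> 1 \<and> s = collapse_height (s * u1) (s * u2) (s * u3)"
  proof (cases "M = 0")
    case True
    then have "u1 = 0" "u2 = 0" "u3 = 0" using M by auto
    then show ?thesis by (intro exI[of _ 1]) (simp add: True collapse_height_def)
  next
    case False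
    then have Mp: "M > 0" using M by linarith
    define F where "F = (\<lambda>s. s - collapse_height (s * u1) (s * u2) (s * u3))"
    have sgn1: "(1 / M * u)\<^sup>2 = 1" if "M = \<bar>u\<bar>" for u
    proof -
      have "(1 / M * u)\<^sup>2 = \<bar>u\<bar>\<^sup>2 / M\<^sup>2" by (simp add: power_mult_distrib power_divide)
      then show ?thesis using that Mp by simp
    qed
    have "collapse_height (1 / M * u1) (1 / M * u2) (1 / M * u3) = 0"
      using M(4) sgn1[of u1] sgn1[of u2] sgn1[of u3] by (auto simp: collapse_height_def)
    then have F1: "F (1 / M) \<ge> 0" using Mp by (simp add: F_def)
    have F0: "F 0 \<le> 0" by (simp add: F_def collapse_height_def)
    have "continuous_on {0..1 / M} F"
      unfolding F_def collapse_height_def by (intro continuous_intros)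
    then obtain s where s: "0 \<le> s" "s \<le> 1 / M" "F s = 0"
      using IVT'[of F 0 0 "1 / M"] F0 F1 Mp by auto
    have "s \<noteq> 0" using s(3) by (auto simp: F_def collapse_height_def)
    then show ?thesis
      using s Mp by (intro exI[of _ s]) (auto simp: F_def field_simps)
  qed
  then obtain s where s: "s > 0" "s * M \<le> 1" "s = collapse_height (s * u1) (s * u2) (s * u3)" by blast
  have bd: "\<bar>s * u\<bar> \<le> 1" if "\<bar>u\<bar> \<le> M" for u
  proof -
    have "s * \<bar>u\<bar> \<le> s * M" by (rule mult_left_mono[OF that]) (use s(1) in simp)
    then have "s * \<bar>u\<bar> \<le> 1" using s(2) by linarith
    then show ?thesis using s(1) by (simp add: abs_mult)
  qed
  define t where "t = (\<lambda>u. (s * u + 1) / 2)"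
  have t: "t u \<in> {0..1}" if "\<bar>u\<bar> \<le> M" for u
    using bd[OF that] by (auto simp: t_def abs_le_iff)
  have ty: "2 * t u - 1 = s * u" for u by (simp add: t_def field_simps)
  define q where "q = (s * u1)\<^sup>2 + (s * u2)\<^sup>2 + (s * u3)\<^sup>2"
  have q: "q = s\<^sup>2 * ((1 + x1) / (1 - x1))"
    unfolding q_def unorm[symmetric] by (simp add: power_mult_distrib algebra_simps)
  have qs: "q + s\<^sup>2 = 2 * s\<^sup>2 / (1 - x1)" "q - s\<^sup>2 = 2 * s\<^sup>2 * x1 / (1 - x1)"
    unfolding q using x1 by (simp_all add: field_simps)
  have c: "cube_collapse (t u1, t u2, t u3) =
     (Complex ((q - s\<^sup>2) / (q + s\<^sup>2)) (2 * s * (s * u1) / (q + s\<^sup>2)),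
      Complex (2 * s * (s * u2) / (q + s\<^sup>2)) (2 * s * (s * u3) / (q + s\<^sup>2)))"
    unfolding cube_collapse_eq ty s(3)[symmetric] q_def by (rule refl)
  have "(q - s\<^sup>2) / (q + s\<^sup>2) = x1" unfolding qs using s(1) x1 by simp
  moreover have "2 * s * (s * u) / (q + s\<^sup>2) = u * (1 - x1)" for u
    unfolding qs using s(1) x1 by (simp add: power2_eq_square)
  ultimately have "cube_collapse (t u1, t u2, t u3) = x"
    unfolding c x by (simp add: ux[symmetric])
  moreover have "(t u1, t u2, t u3) \<in> cube3"
    using t M(1-3) by (simp add: cube3_def)
  ultimately show ?thesis by blast
qed

theorem quotient_map_cube_collapse: "quotient_map (top_of_set cube3) S3 cube_collapse"
proof (rule continuous_imp_quotient_map)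
  show "continuous_map (top_of_set cube3) S3 cube_collapse"
    unfolding S3_def
    by (rule continuous_map_into_subtopology)
      (simp_all only: continuous_map_iff_continuous continuous_on_cube_collapse,
       use cube_collapse_in_sphere in auto)
  have "compact cube3" unfolding cube3_def by (intro compact_Times compact_Icc)
  then show "compact_space (top_of_set cube3)" by (simp add: compact_space_subtopology)
  show "Hausdorff_space S3" by (simp add: S3_def Hausdorff_space_subtopology)
  have "cube_collapse ` cube3 = sphere 0 1"
    using cube_collapse_surj cube_collapse_in_sphere by blast
  then show "cube_collapse ` topspace (top_of_set cube3) = topspace S3" by (simp add: S3_def)
qed

text \<open>The element \<open>[f]\<close> of \<open>\<pi>\<^sub>3(X, f (1, 0))\<close> represented by a map \<open>f\<close> from \<^term>\<open>S3\<close> to \<open>X\<close>.\<close>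

definition sphere_class ::
  "'a topology \<Rightarrow> (complex \<times> complex \<Rightarrow> 'a) \<Rightarrow> (real \<times> real \<times> real \<Rightarrow> 'a) set" where
  "sphere_class X f = cube_class X (f sphere_base) (f \<circ> cube_collapse)"

text \<open>All maps \<open>nh\<close>: those freely homotopic to a pointed map representing \<open>n[h]\<close>. The group is written
  multiplicatively, so \<open>n[h]\<close> is a power.\<close>

definition hopf_multiples ::
  "((complex \<times> complex) set \<Rightarrow> real^3) \<Rightarrow> int \<Rightarrow> (complex \<times> complex \<Rightarrow> real^3) set" where
  "hopf_multiples \<phi> n =
     {g. \<exists>k. continuous_map S3 S2 k \<and> k sphere_base = hopf \<phi> sphere_base \<and>
             sphere_class S2 k = sphere_class S2 (hopf \<phi>) [^]\<^bsub>pi3 S2 (hopf \<phi> sphere_base)\<^esub> n \<and>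
             homotopic_with (\<lambda>_. True) S3 S2 k g}"

lemma cube_collapse_maps:
  assumes "continuous_map S3 X f"
  shows "f \<circ> cube_collapse \<in> cube_maps X (f sphere_base)"
proof -
  have "continuous_map (top_of_set cube3) X (f \<circ> cube_collapse)"
    by (rule continuous_map_compose[OF quotient_imp_continuous_map[OF quotient_map_cube_collapse] assms])
  moreover have "cube_collapse p = sphere_base" if "p \<in> cube3_boundary" for p
    using cube_collapse_eq_base_iff[of p] that by (auto simp: cube3_boundary_def)
  ultimately show ?thesis by (simp add: cube_maps_def)
qed

lemma sphere_base_in_S3: "sphere_base \<in> topspace S3"
  by (simp add: sphere_base_def S3_def norm_Pair)

lemma continuous_map_hopf:
  assumes "homeomorphic_map CP1 S2 \<phi>" shows "continuous_map S3 S2 (hopf \<phi>)"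
proof -
  have "continuous_map S3 S2 (\<phi> \<circ> S1_orbit)"
    using continuous_map_compose[OF quotient_imp_continuous_map[OF quotient_map_quotient_topology]
        homeomorphic_imp_continuous_map[OF assms, unfolded CP1_def]] .
  then show ?thesis by (simp add: hopf_def[abs_def] o_def)
qed

theorem hopf_multiples_nonempty:
  assumes "homeomorphic_map CP1 S2 \<phi>"
  shows "hopf_multiples \<phi> n \<noteq> {}"
proof -
  let ?b = "hopf \<phi> sphere_base"
  let ?h = "sphere_class S2 (hopf \<phi>)"
  have h: "continuous_map S3 S2 (hopf \<phi>)" by (rule continuous_map_hopf[OF assms])
  have b: "?b \<in> topspace S2"
    using continuous_map_image_subset_topspace[OF h] sphere_base_in_S3 by blast
  interpret group "pi3 S2 ?b" by (rule group_pi3[OF b])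
  have "?h \<in> carrier (pi3 S2 ?b)"
    using cube_collapse_maps[OF h] by (simp add: sphere_class_def pi3_def)
  then have "?h [^]\<^bsub>pi3 S2 ?b\<^esub> n \<in> carrier (pi3 S2 ?b)" by (rule int_pow_closed)
  then obtain F where F: "F \<in> cube_maps S2 ?b" "?h [^]\<^bsub>pi3 S2 ?b\<^esub> n = cube_class S2 ?b F"
    by (auto simp: pi3_def)
  have contF: "continuous_map (top_of_set cube3) S2 F" using F by (simp add: cube_maps_def)
  have fibres: "F p = F p'"
    if p: "p \<in> topspace (top_of_set cube3)" "p' \<in> topspace (top_of_set cube3)"
      "cube_collapse p = cube_collapse p'" for p p'
  proof (cases "p \<in> cube3_boundary")
    case True
    then have "p' \<in> cube3_boundary" using p cube_collapse_eq_base_iff[of p] cube_collapse_eq_base_iff[of p'] by simp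
    then show ?thesis using True F(1) by (simp add: cube_maps_def)
  next
    case False
    then have "p' \<notin> cube3_boundary" using p cube_collapse_eq_base_iff[of p] cube_collapse_eq_base_iff[of p'] by simp
    then have "p = p'" using False p by (intro inj_onD[OF inj_on_cube_collapse]) auto
    then show ?thesis by simp
  qed
  obtain k where k: "continuous_map S3 S2 k"
    "\<And>p. p \<in> topspace (top_of_set cube3) \<Longrightarrow> k (cube_collapse p) = F p"
    by (rule quotient_map_lift_exists[OF quotient_map_cube_collapse contF fibres], assumption+) (rule that)
  have 0: "(0, 0, 0) \<in> cube3_boundary" "(0, 0, 0) \<in> cube3"
    by (auto simp: cube3_boundary_def cube3_def)
  then have "cube_collapse (0, 0, 0) = sphere_base" using cube_collapse_eq_base_iff by blast
  then have kb: "k sphere_base = ?b"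
    using k(2)[of "(0, 0, 0)"] 0 F(1) by (simp add: cube_maps_def)
  have "cube_homotopic S2 ?b F (k \<circ> cube_collapse)"
    unfolding cube_homotopic_def
    by (rule homotopic_with_equal)
       (use F(1) cube_collapse_maps[OF k(1)] k(2) kb in \<open>auto simp: cube_maps_def\<close>)
  then have "sphere_class S2 k = cube_class S2 ?b F"
    unfolding sphere_class_def kb using cube_class_eq_iff[OF F(1)] by blast
  then have "k \<in> hopf_multiples \<phi> n"
    unfolding hopf_multiples_def using k(1) kb F(2) by auto
  then show ?thesis by blast
qed

end

theory Submission
  imports Defs
begin

text \<open>Identify \<open>S\<^sup>3\<close> with the unit quaternions. Since \<open>q \<mapsto> q\<^sup>n\<close> is odd or even and the Hopf map is even,
  \<open>q \<mapsto> h (q\<^sup>n)\<close> factors through \<open>\<real>P\<^sup>3\<close>. By the Eckmann--Hilton argument the group law of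
  \<open>\<pi>\<^sub>3(S\<^sup>3)\<close> is induced by the quaternion product, so \<open>q \<mapsto> q\<^sup>n\<close> represents \<open>n[id]\<close>, and \<open>h\<close>
  carries this class to \<open>n[h]\<close>.\<close>

section \<open>Maps of cubes and of the sphere\<close>

text \<open>The core of the Eckmann-Hilton argument. Pad \<open>f\<close> with the constant
  \<open>e\<close> on the second half of the cube and \<open>g\<close> on the first half: the
  pointwise product of the padded maps is the concatenation. Each padding is undone by a
  reparametrisation, and the two homotopies can be multiplied pointwise.\<close>

lemma cube_concat_homotopic_mult:
  assumes m: "continuous_map (prod_topology X X) X (\<lambda>(x, y). m x y)"
    and e: "\<And>x. x \<in> topspace X \<Longrightarrow> m e x = x" "\<And>x. x \<in> topspace X \<Longrightarrow> m x e = x"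
    and f: "f \<in> cube_maps X e" and g: "g \<in> cube_maps X e"
  shows "cube_homotopic X e (cube_concat f g) (\<lambda>p. m (f p) (g p))"
proof -
  \<comment> \<open>\<open>?a\<close> reaches 1 at r = 1/2 and stays there, while \<open>?b\<close>
    stays at 0 until r = 1/2. Hence on either half one of \<open>?f\<close>, \<open>?g\<close> is
    constantly \<open>e\<close>.\<close>
  let ?a = "\<lambda>r::real. min (2 * r) 1" and ?b = "\<lambda>r::real. max (2 * r - 1) 0"
  let ?f = "\<lambda>(r, p). f (?a r, p)" and ?g = "\<lambda>(r, p). g (?b r, p)"
  let ?T = "prod_topology (top_of_set {0..1::real}) (top_of_set cube3)"
  have in_X: "f p \<in> topspace X" "g p \<in> topspace X" if "p \<in> cube3" for p
    using f g that by (auto simp: cube_maps_def continuous_map_def)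
  have e_X: "e \<in> topspace X"
    using f in_X(1)[of "(0, 0, 0)"] by (simp add: cube_maps_def cube3_boundary_def cube3_def)
  have "cube_homotopic X e ?f f"
    by (rule cube_homotopic_reparam[where f = f and a = ?a and b = "\<lambda>r. r"])
      (use f in \<open>auto intro!: continuous_intros\<close>)
  then obtain h where h: "continuous_map ?T X h" "\<And>x. h (0, x) = ?f x" "\<And>x. h (1, x) = f x"
    "\<And>u p. u \<in> {0..1} \<Longrightarrow> p \<in> cube3_boundary \<Longrightarrow> h (u, p) = e"
    unfolding cube_homotopic_def homotopic_with_def by blast
  have "cube_homotopic X e ?g g"
    by (rule cube_homotopic_reparam[where f = g and a = ?b and b = "\<lambda>r. r"])
      (use g in \<open>auto intro!: continuous_intros\<close>)
  then obtain k where k: "continuous_map ?T X k" "\<And>x. k (0, x) = ?g x" "\<And>x. k (1, x) = g x"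
    "\<And>u p. u \<in> {0..1} \<Longrightarrow> p \<in> cube3_boundary \<Longrightarrow> k (u, p) = e"
    unfolding cube_homotopic_def homotopic_with_def by blast
  \<comment> \<open>The product of the two homotopies keeps the boundary at
    \<open>m e e = e\<close>.\<close>
  have "continuous_map ?T X ((\<lambda>(x, y). m x y) \<circ> (\<lambda>z. (h z, k z)))"
    by (intro continuous_map_compose[OF _ m] continuous_map_pairedI h k)
  then have "continuous_map ?T X (\<lambda>z. m (h z) (k z))"
    by (simp add: o_def)
  then have "homotopic_with (\<lambda>k. \<forall>p\<in>cube3_boundary. k p = e) (top_of_set cube3) X
      (\<lambda>p. m (?f p) (?g p)) (\<lambda>p. m (f p) (g p))"
    unfolding homotopic_with_def
    by (intro exI[of _ "\<lambda>z. m (h z) (k z)"]) (use h k e e_X in auto)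
  then show ?thesis
    unfolding cube_homotopic_def
  proof (rule homotopic_with_eq)
    fix x assume x: "x \<in> topspace (top_of_set cube3)"
    obtain r p where rp: "x = (r, p)" by (cases x)
    have p: "p \<in> {0..1} \<times> {0..1}" using x rp by (auto simp: cube3_def)
    have ends: "g (0, p) = e" "f (1, p) = e"
      using f g p by (auto simp: cube_maps_def cube3_boundary_def cube3_def)
    show "cube_concat f g x = m (?f x) (?g x)"
    proof (cases "r \<le> 1/2")
      case True
      then have "(2 * r, p) \<in> cube3" using x rp by (auto simp: cube3_def)
      then show ?thesis using True rp ends e in_X by (simp add: cube_concat_def)
    next
      case False
      then have "(2 * r - 1, p) \<in> cube3" using x rp by (auto simp: cube3_def)
      then show ?thesis using False rp ends e in_X by (simp add: cube_concat_def)
    qed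
  qed (auto simp: cube3_boundary_def)
qed

lemma cube_homotopic_compose:
  assumes "cube_homotopic X x0 f g" "continuous_map X Y h"
  shows "cube_homotopic Y (h x0) (h \<circ> f) (h \<circ> g)"
  using assms unfolding cube_homotopic_def
  by (elim homotopic_with_compose_continuous_map_left) auto

lemma comp_cube_concat: "h \<circ> cube_concat f g = cube_concat (h \<circ> f) (h \<circ> g)"
  by (auto simp: cube_concat_def fun_eq_iff)

lemma sphere_class_in_pi3:
  assumes "continuous_map S3 X f"
  shows "sphere_class X f \<in> carrier (pi3 X (f sphere_base))"
  using cube_collapse_maps[OF assms] by (simp add: sphere_class_def pi3_def)

text \<open>The product lives on \<open>X\<close>, but the classes are compared in \<open>Y\<close>.
  Carrying \<open>h\<close> along gives the law in \<pi>_3 of a space such as \<open>S2\<close>,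
  where no multiplication is at hand.\<close>

lemma sphere_class_mult:
  assumes m: "continuous_map (prod_topology X X) X (\<lambda>(x, y). m x y)"
    and e: "\<And>x. x \<in> topspace X \<Longrightarrow> m e x = x" "\<And>x. x \<in> topspace X \<Longrightarrow> m x e = x"
    and a: "continuous_map S3 X a" "a sphere_base = e"
    and b: "continuous_map S3 X b" "b sphere_base = e"
    and h: "continuous_map X Y h"
  shows "sphere_class Y (\<lambda>z. h (m (a z) (b z))) =
    sphere_class Y (h \<circ> a) \<otimes>\<^bsub>pi3 Y (h e)\<^esub> sphere_class Y (h \<circ> b)"
proof -
  let ?a = "a \<circ> cube_collapse" and ?b = "b \<circ> cube_collapse"
  have a': "?a \<in> cube_maps X e" and b': "?b \<in> cube_maps X e"
    using cube_collapse_maps[OF a(1)] cube_collapse_maps[OF b(1)] a b by simp_all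
  have ha: "h \<circ> ?a \<in> cube_maps Y (h e)" and hb: "h \<circ> ?b \<in> cube_maps Y (h e)"
    using cube_collapse_maps[OF continuous_map_compose[OF a(1) h]]
      cube_collapse_maps[OF continuous_map_compose[OF b(1) h]] a b by (simp_all add: o_assoc)
  have "cube_homotopic Y (h e) (cube_concat (h \<circ> ?a) (h \<circ> ?b)) (h \<circ> (\<lambda>p. m (?a p) (?b p)))"
    using cube_homotopic_compose[OF cube_concat_homotopic_mult[OF m e a' b'] h]
    by (simp add: comp_cube_concat)
  then have "cube_class Y (h e) (h \<circ> (\<lambda>p. m (?a p) (?b p))) =
      cube_class Y (h e) (cube_concat (h \<circ> ?a) (h \<circ> ?b))"
    using cube_class_eq_iff[OF cube_concat_in[OF ha hb]] by blast
  moreover have "e \<in> topspace X"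
    using a sphere_base_in_S3 by (auto simp: continuous_map_def)
  ultimately show ?thesis
    using a b e pi3_mult[OF ha hb] by (simp add: sphere_class_def o_def)
qed

text \<open>Passes from the algebra of cube classes back to free homotopy: a homotopy of cube maps
  is constant on the boundary, so it descends to the collapsed cube \<open>S3\<close>.\<close>

lemma sphere_class_eq_imp_homotopic:
  assumes f: "continuous_map S3 X f" and g: "continuous_map S3 X g"
    and base: "f sphere_base = g sphere_base" and eq: "sphere_class X f = sphere_class X g"
  shows "homotopic_with (\<lambda>_. True) S3 X f g"
proof -
  let ?I = "top_of_set {0..1::real}"
  let ?C = "prod_topology ?I (top_of_set cube3)"
  have "cube_homotopic X (f sphere_base) (f \<circ> cube_collapse) (g \<circ> cube_collapse)"
    using eq cube_class_eq_iff[OF cube_collapse_maps[OF f], of "g \<circ> cube_collapse"]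
    by (simp add: sphere_class_def base)
  then obtain H where H: "continuous_map ?C X H"
    "\<And>x. H (0, x) = f (cube_collapse x)" "\<And>x. H (1, x) = g (cube_collapse x)"
    "\<And>u p. u \<in> {0..1} \<Longrightarrow> p \<in> cube3_boundary \<Longrightarrow> H (u, p) = f sphere_base"
    unfolding cube_homotopic_def homotopic_with_def by auto
  define Q where "Q = (\<lambda>(u::real, p). (u, cube_collapse p))"
  \<comment> \<open>Products of quotient maps need not be quotient maps; here a continuous
    surjection from a compact space onto a Hausdorff space suffices.\<close>
  have Q: "quotient_map ?C (prod_topology ?I S3) Q"
  proof (rule continuous_imp_quotient_map)
    show "continuous_map ?C (prod_topology ?I S3) Q"
      using quotient_imp_continuous_map[OF quotient_map_cube_collapse]
      unfolding Q_def by (simp only: continuous_map_prod_top continuous_map_id[unfolded id_def] simp_thms)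
    have "compact cube3" unfolding cube3_def by (intro compact_Times compact_Icc)
    then show "compact_space ?C" by (simp add: compact_space_subtopology compact_Times)
    show "Hausdorff_space (prod_topology ?I S3)"
      by (simp add: Hausdorff_space_prod_topology Hausdorff_space_subtopology S3_def)
    show "Q ` topspace ?C = topspace (prod_topology ?I S3)"
      using quotient_imp_surjective_map[OF quotient_map_cube_collapse]
      by (simp add: Q_def flip: map_prod_def) (simp add: map_prod_surj_on)
  qed
  \<comment> \<open>At each time \<open>Q\<close> identifies only boundary points with each other,
    and there \<open>H\<close> has the constant value \<open>f sphere_base\<close>.\<close>
  have fibres: "H x = H y" if x: "x \<in> topspace ?C" and y: "y \<in> topspace ?C" and Q_eq: "Q x = Q y" for x y
  proof -
    obtain u p q where xy: "x = (u, p)" "y = (u, q)" and c: "cube_collapse p = cube_collapse q"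
      using Q_eq by (cases x; cases y) (auto simp: Q_def)
    have in_C: "u \<in> {0..1}" "p \<in> cube3" "q \<in> cube3" using x y xy by auto
    show ?thesis
    proof (cases "p \<in> cube3_boundary")
      case True
      then have "q \<in> cube3_boundary" using c in_C cube_collapse_eq_base_iff by metis
      then show ?thesis using True H(4) in_C xy by simp
    next
      case False
      then have "q \<notin> cube3_boundary" using c in_C cube_collapse_eq_base_iff by metis
      then have "p = q" using False in_C c inj_on_cube_collapse by (auto dest: inj_onD)
      then show ?thesis using xy by simp
    qed
  qed
  obtain K where K: "continuous_map (prod_topology ?I S3) X K"
    "\<And>x. x \<in> topspace ?C \<Longrightarrow> K (Q x) = H x"
    by (rule quotient_map_lift_exists[OF Q H(1) fibres], assumption+) (rule that)
  have "K (0, z) = f z" "K (1, z) = g z" if z: "z \<in> topspace S3" for z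
  proof -
    obtain p where p: "p \<in> cube3" "cube_collapse p = z"
      using z quotient_imp_surjective_map[OF quotient_map_cube_collapse, symmetric]
      by (auto simp del: split_paired_All)
    show "K (0, z) = f z" "K (1, z) = g z"
      using K(2)[of "(0, p)"] K(2)[of "(1, p)"] H p by (simp_all add: Q_def)
  qed
  then show ?thesis
    \<comment> \<open>The ends of \<open>K\<close> are known only on \<open>S3\<close>; this
      characterisation, unlike the definition, asks for no more.\<close>
    using K(1) by (subst homotopic_with) auto
qed

section \<open>Unit quaternions\<close>

text \<open>The pair \<open>(a, b)\<close> stands for the quaternion \<open>a + b j\<close>.\<close>

definition qmult :: "complex \<times> complex \<Rightarrow> complex \<times> complex \<Rightarrow> complex \<times> complex" where
  "qmult = (\<lambda>(a, b) (c, d). (a * c - b * cnj d, a * d + b * cnj c))"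

text \<open>Quaternionic conjugation, since b j has conjugate -b j; on unit quaternions it is
  inversion.\<close>

definition qcnj :: "complex \<times> complex \<Rightarrow> complex \<times> complex" where
  "qcnj = (\<lambda>(a, b). (cnj a, - b))"

lemma qmult_base [simp]: "qmult sphere_base z = z" "qmult z sphere_base = z"
  by (cases z; simp add: qmult_def sphere_base_def)+

lemma qmult_minus [simp]: "qmult (- z) w = - qmult z w" "qmult z (- w) = - qmult z w"
  by (cases z; cases w; simp add: qmult_def)+

lemma qmult_in_sphere:
  assumes "z \<in> sphere 0 1" "w \<in> sphere 0 1"
  shows "qmult z w \<in> sphere 0 1"
proof -
  obtain z1 z2 z3 z4 w1 w2 w3 w4
    where zw: "z = (Complex z1 z2, Complex z3 z4)" "w = (Complex w1 w2, Complex w3 w4)"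
    by (metis complex.collapse prod.collapse)
  have "z1\<^sup>2 + z2\<^sup>2 + (z3\<^sup>2 + z4\<^sup>2) = 1" "w1\<^sup>2 + w2\<^sup>2 + (w3\<^sup>2 + w4\<^sup>2) = 1"
    using assms unfolding in_sphere_complex_pair by (simp_all add: zw cmod_power2)
  \<comment> \<open>Euler's four-square identity, that is, multiplicativity of the quaternion
    norm.\<close>
  moreover have "(z1 * w1 - z2 * w2 - (z3 * w3 + z4 * w4))\<^sup>2 + (z1 * w2 + z2 * w1 - (z4 * w3 - z3 * w4))\<^sup>2
      + ((z1 * w3 - z2 * w4 + (z3 * w1 + z4 * w2))\<^sup>2 + (z1 * w4 + z2 * w3 + (z4 * w1 - z3 * w2))\<^sup>2)
    = (z1\<^sup>2 + z2\<^sup>2 + (z3\<^sup>2 + z4\<^sup>2)) * (w1\<^sup>2 + w2\<^sup>2 + (w3\<^sup>2 + w4\<^sup>2))"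
    by algebra
  ultimately show ?thesis
    unfolding in_sphere_complex_pair by (simp add: zw qmult_def cmod_power2)
qed

lemma continuous_map_qmult:
  "continuous_map (prod_topology S3 S3) S3 (\<lambda>(z, w). qmult z w)"
proof -
  have "continuous_on (sphere 0 1 \<times> sphere 0 1) (\<lambda>(z, w). qmult z w)"
    unfolding qmult_def case_prod_beta by (intro continuous_intros)
  then show ?thesis
    using qmult_in_sphere by (auto simp: S3_def prod_topology_subtopology_eu)
qed

lemma continuous_map_qcnj: "continuous_map S3 S3 qcnj"
proof -
  have "continuous_on (sphere 0 1) qcnj"
    unfolding qcnj_def case_prod_beta by (intro continuous_intros)
  then show ?thesis
    by (auto simp: S3_def qcnj_def norm_Pair)
qed

lemma qmult_qcnj: "z \<in> sphere 0 1 \<Longrightarrow> qmult z (qcnj z) = sphere_base"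
  unfolding in_sphere_complex_pair
  by (cases z)
    (simp add: qmult_def qcnj_def sphere_base_def complex_norm_square[symmetric]
      of_real_add[symmetric] del: of_real_add of_real_power)

text \<open>The witness is the n-th quaternion power. Its class is computed only after composition
  with \<open>h\<close>, so \<pi>_3 of the sphere itself and degrees never enter.\<close>

lemma ex_equivariant_sphere_map_power:
  fixes n :: int
  assumes h: "continuous_map S3 Y h"
  shows "\<exists>a. continuous_map S3 S3 a \<and> a sphere_base = sphere_base \<and>
    ((\<forall>z. a (- z) = a z) \<or> (\<forall>z. a (- z) = - a z)) \<and>
    sphere_class Y (h \<circ> a) = sphere_class Y h [^]\<^bsub>pi3 Y (h sphere_base)\<^esub> n"
proof -
  let ?G = "pi3 Y (h sphere_base)"
  let ?c = "sphere_class Y h" and ?i = "sphere_class Y (h \<circ> qcnj)"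
  have "h sphere_base \<in> topspace Y"
    using h sphere_base_in_S3 by (auto simp: continuous_map_def)
  then interpret group ?G by (rule group_pi3)
  have mult: "sphere_class Y (h \<circ> (\<lambda>z. qmult (a z) (b z))) = sphere_class Y (h \<circ> a) \<otimes>\<^bsub>?G\<^esub> sphere_class Y (h \<circ> b)"
    if "continuous_map S3 S3 a" "a sphere_base = sphere_base"
      "continuous_map S3 S3 b" "b sphere_base = sphere_base" for a b
    using sphere_class_mult[OF continuous_map_qmult _ _ that h] by (simp add: o_def)
  have cont: "continuous_map S3 S3 (\<lambda>z. qmult (a z) (b z))"
    if "continuous_map S3 S3 a" "continuous_map S3 S3 b" for a b
    using continuous_map_compose[OF continuous_map_pairedI[OF that] continuous_map_qmult]
    by (simp add: o_def)
  have cnj_base: "qcnj sphere_base = sphere_base" by (simp add: qcnj_def sphere_base_def)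
  have id: "continuous_map S3 S3 (\<lambda>z. z)" by simp
  have one: "sphere_class Y (h \<circ> (\<lambda>_. sphere_base)) = \<one>\<^bsub>?G\<^esub>"
    by (simp add: sphere_class_def pi3_def o_def)
  have c: "?c \<in> carrier ?G" by (rule sphere_class_in_pi3[OF h])
  have i: "?i \<in> carrier ?G"
    using sphere_class_in_pi3[OF continuous_map_compose[OF continuous_map_qcnj h]] cnj_base by simp
  \<comment> \<open>The identity \<open>qmult_qcnj\<close> holds on the unit sphere only; that is
    enough, because \<open>sphere_class\<close> looks at a map through
    \<open>cube_collapse\<close>.\<close>
  have "qmult (cube_collapse p) (qcnj (cube_collapse p)) = sphere_base" for p
    using cube_collapse_in_sphere by (rule qmult_qcnj)
  then have "sphere_class Y (h \<circ> (\<lambda>z. qmult z (qcnj z))) = sphere_class Y (h \<circ> (\<lambda>_. sphere_base))"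
    by (simp add: sphere_class_def o_def cnj_base)
  then have "?c \<otimes>\<^bsub>?G\<^esub> ?i = \<one>\<^bsub>?G\<^esub>"
    using mult[OF id refl continuous_map_qcnj cnj_base] one by (simp add: o_def)
  \<comment> \<open>Conjugation represents the inverse class, so the induction can run downwards as
    well as upwards from 0.\<close>
  then have inv: "?i = inv\<^bsub>?G\<^esub> ?c"
    using c i by (metis inv_equality inv_inv inv_closed)
  have cnj_minus: "qcnj (- z) = - qcnj z" for z by (cases z) (simp add: qcnj_def)
  show ?thesis
  proof (induction n rule: int_induct[where k = 0])
    case base
    show ?case
      by (rule exI[of _ "\<lambda>_. sphere_base"]) (use one sphere_base_in_S3 in auto)
  next
    case (step1 n)
    then obtain a where a: "continuous_map S3 S3 a" "a sphere_base = sphere_base"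
      "(\<forall>z. a (- z) = a z) \<or> (\<forall>z. a (- z) = - a z)"
      "sphere_class Y (h \<circ> a) = ?c [^]\<^bsub>?G\<^esub> n" by blast
    have "sphere_class Y (h \<circ> (\<lambda>z. qmult (a z) z)) = ?c [^]\<^bsub>?G\<^esub> (n + 1)"
      using a(4) c mult[OF a(1,2) id refl] by (simp add: int_pow_mult int_pow_1 o_def)
    \<comment> \<open>The new factor is odd, so even and odd change places.\<close>
    moreover have "(\<forall>z. qmult (a (- z)) (- z) = qmult (a z) z) \<or>
        (\<forall>z. qmult (a (- z)) (- z) = - qmult (a z) z)"
      using a(3) by (elim disjE) (simp_all del: split_paired_All)
    ultimately show ?case
      using a(2) cont[OF a(1) id] by (intro exI[of _ "\<lambda>z. qmult (a z) z"]) (simp add: o_def)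
  next
    case (step2 n)
    then obtain a where a: "continuous_map S3 S3 a" "a sphere_base = sphere_base"
      "(\<forall>z. a (- z) = a z) \<or> (\<forall>z. a (- z) = - a z)"
      "sphere_class Y (h \<circ> a) = ?c [^]\<^bsub>?G\<^esub> n" by blast
    have "sphere_class Y (h \<circ> (\<lambda>z. qmult (a z) (qcnj z))) = ?c [^]\<^bsub>?G\<^esub> (n - 1)"
      using a(4) c mult[OF a(1,2) continuous_map_qcnj cnj_base]
      by (simp add: int_pow_diff int_pow_1 inv)
    moreover have "(\<forall>z. qmult (a (- z)) (qcnj (- z)) = qmult (a z) (qcnj z)) \<or>
        (\<forall>z. qmult (a (- z)) (qcnj (- z)) = - qmult (a z) (qcnj z))"
      using a(3) by (elim disjE) (simp_all add: cnj_minus del: split_paired_All)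
    ultimately show ?case
      using a(2) cont[OF a(1) continuous_map_qcnj] cnj_base
      by (intro exI[of _ "\<lambda>z. qmult (a z) (qcnj z)"]) (simp add: o_def)
  qed
qed

section \<open>Descent to projective space\<close>

lemma hopf_minus: "hopf \<phi> (- z) = hopf \<phi> z"
proof -
  have "S1_orbit z = S1_orbit (- z)"
    \<comment> \<open>Antipodal points share an orbit because -1 lies in the circle.\<close>
    unfolding S1_orbit_eq_iff by (rule exI[of _ "- 1"]) (simp add: prod_eq_iff)
  then show ?thesis by (simp add: hopf_def)
qed

theorem proposition2p1:
  fixes \<phi> :: "(complex \<times> complex) set \<Rightarrow> real^3" and n :: int
  assumes "homeomorphic_map CP1 S2 \<phi>"
  shows "\<exists>h'. continuous_map RP3 S2 h' \<and>
              (\<forall>g \<in> hopf_multiples \<phi> n. homotopic_with (\<lambda>_. True) S3 S2 (h' \<circ> p3) g)"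
proof -
  have h: "continuous_map S3 S2 (hopf \<phi>)" by (rule continuous_map_hopf[OF assms])
  obtain a where a: "continuous_map S3 S3 a" "a sphere_base = sphere_base"
    "(\<forall>z. a (- z) = a z) \<or> (\<forall>z. a (- z) = - a z)"
    "sphere_class S2 (hopf \<phi> \<circ> a) =
      sphere_class S2 (hopf \<phi>) [^]\<^bsub>pi3 S2 (hopf \<phi> sphere_base)\<^esub> n"
    using ex_equivariant_sphere_map_power[OF h] by blast
  have ha: "continuous_map S3 S2 (hopf \<phi> \<circ> a)" by (rule continuous_map_compose[OF a(1) h])
  have fibres: "(hopf \<phi> \<circ> a) z = (hopf \<phi> \<circ> a) w" if "p3 z = p3 w" for z w
  proof -
    have "w = z \<or> w = - z" using that by (auto simp: antipodal_class_def doubleton_eq_iff)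
    \<comment> \<open>If \<open>a\<close> is odd, the sign it produces is absorbed by the even map
      \<open>hopf \<phi>\<close>.\<close>
    then show ?thesis using a(3) by (metis comp_apply hopf_minus)
  qed
  have q: "quotient_map S3 RP3 p3"
    unfolding RP3_def by (rule quotient_map_quotient_topology)
  obtain h' where h': "continuous_map RP3 S2 h'"
    "\<And>z. z \<in> topspace S3 \<Longrightarrow> h' (p3 z) = (hopf \<phi> \<circ> a) z"
    by (rule quotient_map_lift_exists[OF q ha fibres], assumption) (rule that)
  have "homotopic_with (\<lambda>_. True) S3 S2 (h' \<circ> p3) g" if g: "g \<in> hopf_multiples \<phi> n" for g
  proof -
    obtain k where k: "continuous_map S3 S2 k" "k sphere_base = hopf \<phi> sphere_base"
      "sphere_class S2 k = sphere_class S2 (hopf \<phi>) [^]\<^bsub>pi3 S2 (hopf \<phi> sphere_base)\<^esub> n"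
      "homotopic_with (\<lambda>_. True) S3 S2 k g"
      using g unfolding hopf_multiples_def by blast
    have "homotopic_with (\<lambda>_. True) S3 S2 (h' \<circ> p3) (hopf \<phi> \<circ> a)"
      by (rule homotopic_with_equal)
        (use h' ha continuous_map_compose[OF quotient_imp_continuous_map[OF q] h'(1)] in auto)
    \<comment> \<open>Both maps represent n[h] at the same base point.\<close>
    moreover have "homotopic_with (\<lambda>_. True) S3 S2 (hopf \<phi> \<circ> a) k"
      by (rule sphere_class_eq_imp_homotopic[OF ha k(1)]) (use a k in simp_all)
    ultimately show ?thesis using k(4) homotopic_with_trans by blast
  qed
  then show ?thesis using h'(1) by blast
qed

end
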